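(* The restrictions $\Phi_1$ of $\Phi$ to $Av(T_1)$ and $\Phi_2$ of $\Phi$ to $Av(T_2)$ are both bijections onto the set of Dyck prefixes of even length; more precisely, for every $n\ge0$, each $\Phi_i$ maps $S_{n+1}(T_i)$ bijectively onto the set of Dyck prefixes of length $2n$. Hence $|S_{n+1}(T_1)|=|S_{n+1}(T_2)|=\binom{2n}{n}$ for every $n\ge 0$.
   Context: A permutation $\sigma$ avoids $\tau$ if no subsequence of $\sigma$ has the same relative order as $\tau$. Let $T_1=\{3214,3241,4213,4231\}$ and $T_2=\{3124,3142,4123,4132\}$; $Av(T)$ is the set of permutations avoiding all patterns of $T$, and $S_n(T)=Av(T)\cap S_n$. A Dyck prefix is a lattice path starting at the origin with steps $U=(1,1)$ and $D=(1,-1)$ that never goes below the $x$-axis (equivalently a word in $U,D$ each of whose initial subwords has at least as many $U$'s as $D$'s). The map $\Phi$ from $Av(T_1)\cup Av(T_2)$ to Dyck prefixes is defined as follows. The permutation $1$ is mapped to the empty path. For $n\ge1$ and $\sigma\in S_{n+1}(T_1)\cup S_{n+1}(T_2)$, write $\sigma=M_1w_1M_2w_2\cdots M_kw_k$, where $M_1<\cdots<M_k=n+1$ are the left-to-right maxima of $\sigma$ (entries larger than all preceding entries) and $w_i$ is a possibly empty word of length $l_i$; set $M_0=0$. If $w_k$ is empty, $\Phi(\sigma)=U^{M_1-M_0}D^{l_1+1}U^{M_2-M_1}D^{l_2+1}\cdots U^{M_{k-1}-M_{k-2}}D^{l_{k-1}+1}$. If $w_k=x_1\cdots x_{l_k}$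 is nonempty, $\Phi(\sigma)=U^{M_1-M_0}D^{l_1+1}\cdots U^{M_{k-1}-M_{k-2}}D^{l_{k-1}+1}U^{M_k-M_{k-1}}Q_1\cdots Q_{l_k-1}$, where $Q_j=U$ if $x_j=\max\{x_j,x_{j+1},\dots,x_{l_k}\}$ and $Q_j=D$ otherwise. *)

theory Defs
  imports "HOL-Library.Sublist" "HOL-Combinatorics.Multiset_Permutations"
begin

text \<open>Permutations of \<open>{1..n}\<close> are written in one-line notation, as the lists in
  \<^term>\<open>permutations_of_set {1..n::nat}\<close>.\<close>

definition same_relative_order :: "nat list \<Rightarrow> nat list \<Rightarrow> bool" where
  "same_relative_order xs ys \<longleftrightarrow>
     length xs = length ys \<and>
     (\<forall>i<length xs. \<forall>j<length xs. xs ! i < xs ! j \<longleftrightarrow> ys ! i < ys ! j)"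

definition avoids :: "nat list \<Rightarrow> nat list \<Rightarrow> bool" where
  "avoids \<sigma> \<tau> \<longleftrightarrow> \<not> (\<exists>\<rho>. subseq \<rho> \<sigma> \<and> same_relative_order \<rho> \<tau>)"

text \<open>Permutations of size \<open>0\<close> are excluded: the map \<open>\<Phi>\<close> below is only considered on
  permutations of size at least \<open>1\<close>.\<close>

definition Av :: "nat list set \<Rightarrow> nat list set" where
  "Av T = {\<sigma>. (\<exists>n\<ge>1. \<sigma> \<in> permutations_of_set {1..n}) \<and> (\<forall>\<tau>\<in>T. avoids \<sigma> \<tau>)}"

definition Av_n :: "nat \<Rightarrow> nat list set \<Rightarrow> nat list set" where
  "Av_n n T = Av T \<inter> permutations_of_set {1..n}"

definition T1 :: "nat list set" where
  "T1 = {[3,2,1,4], [3,2,4,1], [4,2,1,3], [4,2,3,1]}"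

definition T2 :: "nat list set" where
  "T2 = {[3,1,2,4], [3,1,4,2], [4,1,2,3], [4,1,3,2]}"

datatype step = U | D

definition dyck_prefix :: "step list \<Rightarrow> bool" where
  "dyck_prefix p \<longleftrightarrow> (\<forall>q. prefix q p \<longrightarrow> count_list q D \<le> count_list q U)"

text \<open>The factorisation \<open>\<sigma> = M\<^sub>1 w\<^sub>1 \<dots> M\<^sub>k w\<^sub>k\<close> at the left-to-right maxima, as the list
  \<open>[(M\<^sub>1, w\<^sub>1), \<dots>, (M\<^sub>k, w\<^sub>k)]\<close>: \<open>w\<^sub>i\<close> consists of the entries following \<open>M\<^sub>i\<close> up to the first
  one exceeding it, which is \<open>M\<^sub>i\<^sub>+\<^sub>1\<close>.  The three lemmas after the definition characterise it.\<close>

function lr_max_blocks :: "nat list \<Rightarrow> (nat \<times> nat list) list" where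
  "lr_max_blocks [] = []"
| "lr_max_blocks (x # xs) =
     (x, takeWhile (\<lambda>y. y < x) xs) # lr_max_blocks (dropWhile (\<lambda>y. y < x) xs)"
  by pat_completeness auto
termination
  by (relation "measure length") (auto simp: le_imp_less_Suc length_dropWhile_le)

lemma concat_lr_max_blocks: "concat (map (\<lambda>(M, w). M # w) (lr_max_blocks \<sigma>)) = \<sigma>"
  by (induction \<sigma> rule: lr_max_blocks.induct) auto

lemma lr_max_blocks_less: "(M, w) \<in> set (lr_max_blocks \<sigma>) \<Longrightarrow> y \<in> set w \<Longrightarrow> y < M"
  by (induction \<sigma> rule: lr_max_blocks.induct) (auto dest: set_takeWhileD)

lemma lr_max_blocks_sorted: "distinct \<sigma> \<Longrightarrow> sorted_wrt (<) (map fst (lr_max_blocks \<sigma>))"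
proof (induction \<sigma> rule: lr_max_blocks.induct)
  case 1
  show ?case by simp
next
  case (2 x xs)
  define ys where "ys = dropWhile (\<lambda>y. y < x) xs"
  have sub: "set ys \<subseteq> set xs"
    unfolding ys_def by (auto dest: set_dropWhileD)
  have IH: "sorted_wrt (<) (map fst (lr_max_blocks ys))"
    using 2 unfolding ys_def by simp
  have "\<forall>M\<in>set (map fst (lr_max_blocks ys)). x < M"
  proof (cases ys)
    case Nil
    then show ?thesis by simp
  next
    case (Cons z zs)
    then have "\<not> z < x"
      unfolding ys_def by (metis hd_dropWhile list.distinct(1) list.sel(1))
    moreover have "z \<noteq> x"
      using sub Cons "2.prems" by auto
    ultimately have "x < z" by simp
    then show ?thesis using IH Cons by auto
  qed
  then show ?case using IH by (simp add: ys_def)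
qed

definition Phi :: "nat list \<Rightarrow> step list" where
  "Phi \<sigma> =
    (let bs = lr_max_blocks \<sigma>;
         k = length bs;
         M = (\<lambda>i. if i = 0 then 0 else fst (bs ! (i - 1)));
         w = (\<lambda>i. snd (bs ! (i - 1)))
     in concat (map (\<lambda>i. replicate (M i - M (i - 1)) U @ replicate (length (w i) + 1) D) [1..<k])
        @ (if w k = [] then []
           else replicate (M k - M (k - 1)) U
                @ map (\<lambda>j. if w k ! j = Max (set (drop j (w k))) then U else D)
                      [0..<length (w k) - 1]))"

end

theory Submission
  imports Defs
begin

text \<open>Avoiding the patterns constrains each entry \<open>x\<close> that is not a left-to-right maximum. For
  \<open>T1\<close>, it cannot be followed by both a smaller and a larger entry, so it is the least or the
  greatest of the entries not yet used. For \<open>T2\<close>, writing \<open>m\<close> for the maximum of the preceding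
  entries, it cannot be followed by distinct \<open>y < z\<close> with \<open>x < y < m\<close>: before the overall maximum
  \<open>x\<close> is therefore the greatest unused entry below \<open>m\<close>, and after it one of the two greatest unused
  entries. In both cases reading the path from left to right recovers the permutation: the up-steps
  give the left-to-right maxima, a down-step before the overall maximum consumes the unique admissible
  unused entry (one exists because the height counts the unused entries below \<open>m\<close>), and each step
  after it chooses between two candidates.\<close>

section \<open>Dyck prefixes from a given height\<close>

fun dyck_from :: "nat \<Rightarrow> step list \<Rightarrow> bool" where
  "dyck_from h [] = True"
| "dyck_from h (U # p) = dyck_from (Suc h) p"
| "dyck_from h (D # p) = (h > 0 \<and> dyck_from (h - 1) p)"

lemma dyck_from_iff:
  "dyck_from h p \<longleftrightarrow> (\<forall>q. prefix q p \<longrightarrow> count_list q D \<le> count_list q U + h)"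
proof (induction h p rule: dyck_from.induct)
  case (3 h p)
  have "(\<forall>q. prefix q (D # p) \<longrightarrow> count_list q D \<le> count_list q U + h) \<longleftrightarrow>
      (\<forall>q. prefix q p \<longrightarrow> Suc (count_list q D) \<le> count_list q U + h)"
    by (auto simp: prefix_Cons)
  also have "\<dots> \<longleftrightarrow> h > 0 \<and> (\<forall>q. prefix q p \<longrightarrow> count_list q D \<le> count_list q U + (h - 1))"
    \<comment> \<open>The empty \<open>q\<close> yields \<open>h > 0\<close>; after that one unit
      moves from the left side of the inequality to the right.\<close>
    by (cases h) (auto intro: exI[of _ "[]"])
  finally show ?case using 3 by auto
qed (auto simp: prefix_Cons)

lemma dyck_prefix_iff_dyck_from: "dyck_prefix p \<longleftrightarrow> dyck_from 0 p"
  by (simp add: dyck_prefix_def dyck_from_iff)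

lemma dyck_from_replicate_U: "dyck_from h (replicate j U @ p) \<longleftrightarrow> dyck_from (h + j) p"
  by (induction j arbitrary: h) auto

text \<open>Serves the steps after the overall maximum, which are arbitrary: too few of them remain
  to get below the axis.\<close>

lemma dyck_from_of_length_le: "length p \<le> h \<Longrightarrow> dyck_from h p"
  by (induction h p rule: dyck_from.induct) auto

section \<open>Counting Dyck prefixes of given length and starting height\<close>

definition choose_int :: "nat \<Rightarrow> int \<Rightarrow> nat" where
  "choose_int l d = (if d < 0 then 0 else l choose nat d)"

text \<open>Since the coefficient is set to zero at negative \<open>d\<close>, Pascal's rule holds
  at every integer and the sums below need no boundary cases.\<close>

lemma choose_int_Suc: "choose_int (Suc l) d = choose_int l d + choose_int l (d - 1)"
proof (cases "d \<le> 0")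
  case False
  then have "nat d = Suc (nat (d - 1))" by simp
  then show ?thesis using False by (simp add: choose_int_def)
qed (auto simp: choose_int_def)

lemma finite_dyck_from: "finite {p. dyck_from h p \<and> length p = l}"
proof -
  have "finite {p :: step list. set p \<subseteq> {U, D} \<and> length p = l}"
    by (rule finite_lists_length_eq) simp
  moreover have "set p \<subseteq> {U, D}" for p using step.exhaust by auto
  ultimately show ?thesis by (elim finite_subset[rotated]) auto
qed

lemma card_dyck_from_0:
  "card {p. dyck_from 0 p \<and> length p = Suc l} = card {p. dyck_from 1 p \<and> length p = l}"
proof -
  have "{p. dyck_from 0 p \<and> length p = Suc l} = (#) U ` {p. dyck_from 1 p \<and> length p = l}"
    (is "?A = ?B")
  proof
    show "?A \<subseteq> ?B"
    proof
      fix p assume "p \<in> ?A"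
      then show "p \<in> ?B" by (cases "(0::nat, p)" rule: dyck_from.cases) auto
    qed
  qed auto
  then show ?thesis by (simp add: card_image)
qed

lemma card_dyck_from_Suc:
  "card {p. dyck_from (Suc h) p \<and> length p = Suc l} =
    card {p. dyck_from h p \<and> length p = l} + card {p. dyck_from (Suc (Suc h)) p \<and> length p = l}"
proof -
  have "{p. dyck_from (Suc h) p \<and> length p = Suc l} =
      (#) D ` {p. dyck_from h p \<and> length p = l}
      \<union> (#) U ` {p. dyck_from (Suc (Suc h)) p \<and> length p = l}" (is "?A = ?B")
  proof
    show "?A \<subseteq> ?B"
    proof
      fix p assume "p \<in> ?A"
      then show "p \<in> ?B" by (cases "(Suc h, p)" rule: dyck_from.cases) auto
    qed
  qed auto
  then show ?thesis
    by (subst \<open>_ = _\<close>, subst card_Un_disjoint) (auto simp: card_image finite_dyck_from)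
qed

text \<open>By the reflection principle, a prefix of length \<open>l\<close> from height \<open>h\<close> corresponds to an
  unrestricted path whose total displacement \<open>l - 2 d\<close> lies in \<open>{-h..h+1}\<close>.\<close>

lemma card_dyck_from:
  "card {p. dyck_from h p \<and> length p = l} =
    (\<Sum>d = (int l - int h) div 2..(int l + int h) div 2. choose_int l d)"
proof (induction l arbitrary: h)
  case 0
  have "(\<Sum>d = (- int h) div 2..int h div 2. choose_int 0 d) =
      (\<Sum>d = (- int h) div 2..int h div 2. if d = 0 then 1 else 0)"
    by (rule sum.cong) (auto simp: choose_int_def)
  moreover have "{p. dyck_from h p \<and> length p = 0} = {[]}" by auto
  ultimately show ?case by simp
next
  case (Suc l)
  show ?case
  proof (cases h)
    case 0
    \<comment> \<open>From height \<open>0\<close> the first step is \<open>U\<close>, and from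
      height \<open>1\<close> only \<open>d = q - 1\<close> and \<open>d = q\<close> contribute;
      Pascal's rule merges them.\<close>
    define q where "q = (int l + 1) div 2"
    have "(int l - 1) div 2 = q - 1" unfolding q_def by presburger
    moreover have "{q - 1..q} = {q - 1, q}" by auto
    ultimately have "card {p. dyck_from 1 p \<and> length p = l} = choose_int (Suc l) q"
      using Suc[of 1] by (simp add: choose_int_Suc q_def[symmetric])
    moreover have "(int (Suc l) - int h) div 2 = q" "(int (Suc l) + int h) div 2 = q"
      using 0 by (simp_all add: q_def algebra_simps)
    ultimately show ?thesis by (simp only: 0 card_dyck_from_0) simp
  next
    case (Suc h')
    define a where "a = (int l - int h') div 2"
    define b where "b = (int l + int h') div 2"
    have ab: "a \<le> b" unfolding a_def b_def by (intro zdiv_mono1) auto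
    have e: "(int l - int (Suc (Suc h'))) div 2 = a - 1"
        "(int l + int (Suc (Suc h'))) div 2 = b + 1"
        "(int (Suc l) - int (Suc h')) div 2 = a" "(int (Suc l) + int (Suc h')) div 2 = b + 1"
      unfolding a_def b_def by presburger+
    have top: "sum F {i..b + 1} = sum F {i..b} + F (b + 1)"
      if "i \<le> b + 1" for F :: "int \<Rightarrow> nat" and i
    proof -
      have "{i..b + 1} = insert (b + 1) {i..b}" using that by auto
      then show ?thesis by simp
    qed
    have shift: "(\<Sum>d = a..b + 1. choose_int l (d - 1)) = sum (choose_int l) {a - 1..b}"
      by (rule sum.reindex_bij_witness[where i = "\<lambda>d. d + 1" and j = "\<lambda>d. d - 1"]) auto
    have "card {p. dyck_from h p \<and> length p = Suc l} =
        sum (choose_int l) {a..b} + sum (choose_int l) {a - 1..b + 1}"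
      using Suc.IH[of h'] Suc.IH[of "Suc (Suc h')"]
      by (simp only: Suc card_dyck_from_Suc e a_def[symmetric] b_def[symmetric])
    \<comment> \<open>Moving the term at \<open>b + 1\<close> from the second sum to the first makes
      the two ranges translates of each other, as Pascal's rule requires.\<close>
    also have "\<dots> = sum (choose_int l) {a..b + 1} + sum (choose_int l) {a - 1..b}"
      using ab by (simp add: top)
    also have "\<dots> = (\<Sum>d = a..b + 1. choose_int (Suc l) d)"
      by (simp add: choose_int_Suc sum.distrib shift)
    finally show ?thesis by (simp only: Suc e)
  qed
qed

text \<open>For \<open>h = 0\<close> and even length the range of \<open>d\<close> is the single
  point \<open>n\<close>.\<close>

lemma card_dyck_prefix: "card {p. dyck_prefix p \<and> length p = 2 * n} = (2 * n) choose n"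
  using card_dyck_from[of 0 "2 * n"] by (simp add: dyck_prefix_iff_dyck_from choose_int_def)

section \<open>A recursive form of the map\<close>

text \<open>Here \<open>m\<close> is the maximum so far. A left-to-right maximum other than the
  overall one emits, besides its up-steps, the extra \<open>D\<close> of
  \<open>l\<^sub>i + 1\<close>. The last entry emits nothing, which covers both an empty last block
  and the missing last letter of a nonempty one.\<close>

fun lr_path :: "nat \<Rightarrow> nat list \<Rightarrow> step list" where
  "lr_path m [] = []"
| "lr_path m (x # xs) =
    (if xs = [] then []
     else (if m < x then replicate (x - m) U @ (if \<exists>y\<in>set xs. x < y then [D] else [])
           else if \<exists>y\<in>set xs. m < y then [D]
           else [if x = Max (set (x # xs)) then U else D])
          @ lr_path (max m x) xs)"

definition last_block_path :: "nat list \<Rightarrow> step list" where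
  "last_block_path w =
    map (\<lambda>j. if w ! j = Max (set (drop j w)) then U else D) [0..<length w - 1]"

text \<open>Mediates between the indexed formula of \<open>Phi\<close> and \<open>lr_path\<close>:
  the recursion runs over whole blocks, with the preceding maximum as \<open>m\<close>.\<close>

fun blocks_path :: "nat \<Rightarrow> (nat \<times> nat list) list \<Rightarrow> step list" where
  "blocks_path m [] = []"
| "blocks_path m [(M, w)] = (if w = [] then [] else replicate (M - m) U @ last_block_path w)"
| "blocks_path m ((M, w) # b # bs) =
    replicate (M - m) U @ replicate (length w + 1) D @ blocks_path M (b # bs)"

section \<open>Agreement of the recursive and the indexed form\<close>

lemma last_block_path_Cons:
  "xs \<noteq> [] \<Longrightarrow>
    last_block_path (x # xs) = (if x = Max (set (x # xs)) then U else D) # last_block_path xs"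
  by (cases xs) (simp_all add: last_block_path_def upt_conv_Cons map_Suc_upt[symmetric] o_def
      del: upt_Suc)

lemma lr_path_last_block: "\<forall>x\<in>set w. x < m \<Longrightarrow> lr_path m w = last_block_path w"
proof (induction w)
  case (Cons x w)
  then show ?case
    by (cases "w = []") (auto simp: last_block_path_Cons max_def, simp add: last_block_path_def)
qed (simp add: last_block_path_def)

lemma lr_path_inner_block:
  "\<forall>x\<in>set w. x < m \<Longrightarrow> \<exists>y\<in>set zs. m < y \<Longrightarrow>
    lr_path m (w @ zs) = replicate (length w) D @ lr_path m zs"
  by (induction w) (auto simp: max_def)

text \<open>One block is removed at a time. Its entries lie below its maximum \<open>x\<close>, so
  they give one \<open>D\<close> each if a later block exists and the last-block word otherwise. By
  \<open>m < hd \<sigma>\<close> the first entry is a new maximum.\<close>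

lemma blocks_path_lr_max_blocks:
  assumes "distinct \<sigma>" "\<sigma> \<noteq> []" "m < hd \<sigma>"
  shows "blocks_path m (lr_max_blocks \<sigma>) = lr_path m \<sigma>"
  using assms
proof (induction \<sigma> arbitrary: m rule: lr_max_blocks.induct)
  case (2 x xs)
  define w where "w = takeWhile (\<lambda>y. y < x) xs"
  define zs where "zs = dropWhile (\<lambda>y. y < x) xs"
  have xs: "xs = w @ zs" by (simp add: w_def zs_def)
  have w: "\<forall>y\<in>set w. y < x" by (auto simp: w_def dest: set_takeWhileD)
  have mx: "m < x" using 2 by simp
  show ?case
  proof (cases zs)
    case Nil
    then have "\<not> (\<exists>y\<in>set w. x < y)" "xs = w" using w xs by auto
    moreover have "lr_max_blocks (x # xs) = [(x, w)]"
      by (simp only: lr_max_blocks.simps w_def[symmetric] zs_def[symmetric] Nil)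
    ultimately show ?thesis
      using mx w by (simp add: lr_path_last_block max_def del: lr_max_blocks.simps)
  next
    case (Cons z zs')
    then have "\<not> z < x" by (metis hd_dropWhile list.distinct(1) list.sel(1) zs_def)
    moreover have "z \<noteq> x" using "2.prems"(1) xs Cons by auto
    ultimately have z: "x < z" by simp
    have "blocks_path x (lr_max_blocks zs) = lr_path x zs"
      using "2.IH"[of x] "2.prems"(1) Cons z xs unfolding zs_def[symmetric] by auto
    moreover have "\<exists>y\<in>set xs. x < y" "xs \<noteq> []" using Cons z xs by auto
    moreover have "lr_max_blocks (x # xs) = (x, w) # lr_max_blocks zs"
      by (simp add: w_def zs_def)
    moreover obtain b bs where "lr_max_blocks zs = b # bs" using Cons by simp
    moreover have "lr_path x xs = replicate (length w) D @ lr_path x zs"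
      using lr_path_inner_block[OF w, of zs] Cons z xs by auto
    ultimately show ?thesis using mx by (auto simp: max_def)
  qed
qed simp

lemma blocks_path_eq:
  fixes m :: nat and bs :: "(nat \<times> nat list) list"
  assumes "bs \<noteq> []"
  defines "k \<equiv> length bs" and "M \<equiv> (\<lambda>i. if i = 0 then m else fst (bs ! (i - 1)))"
    and "w \<equiv> (\<lambda>i. snd (bs ! (i - 1)))"
  shows "blocks_path m bs =
      concat (map (\<lambda>i. replicate (M i - M (i - 1)) U @ replicate (length (w i) + 1) D) [1..<k])
      @ (if w k = [] then [] else replicate (M k - M (k - 1)) U @ last_block_path (w k))"
  using assms(1) unfolding assms(2-)
proof (induction m bs rule: blocks_path.induct)
  case (3 m M w b bs)
  define F where "F = (\<lambda>m bs i. replicate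
      ((if i = 0 then m else fst (bs ! (i - 1))) - (if i - 1 = 0 then m else fst (bs ! (i - 1 - 1)))) U
      @ replicate (length (snd (bs ! (i - 1)) :: nat list) + 1) D)"
  \<comment> \<open>Dropping the first block shifts the index by one and changes the value at index
    \<open>0\<close> from \<open>m\<close> to \<open>M\<close>.\<close>
  have "F m ((M, w) # b # bs) (Suc i) = F M (b # bs) i" if "i > 0" for i
    using that by (cases i) (auto simp: F_def nth_Cons')
  then have "map (F m ((M, w) # b # bs)) (map Suc [1..<length (b # bs)]) =
      map (F M (b # bs)) [1..<length (b # bs)]" by (auto simp del: upt_Suc)
  moreover have F_Suc0: "F m ((M, w) # b # bs) 1 = replicate (M - m) U @ replicate (length w + 1) D"
    by (simp add: F_def)
  moreover have "[1..<length ((M, w) # b # bs)] = 1 # map Suc [1..<length (b # bs)]"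
    by (simp add: upt_conv_Cons map_Suc_upt del: upt_Suc)
  ultimately have "concat (map (F m ((M, w) # b # bs)) [1..<length ((M, w) # b # bs)]) =
      replicate (M - m) U @ replicate (length w + 1) D
      @ concat (map (F M (b # bs)) [1..<length (b # bs)])"
    by (simp only: list.map concat.simps F_Suc0 append_assoc)
  then show ?case using 3 unfolding F_def by (simp add: nth_Cons' del: upt_Suc)
qed auto

lemma Phi_eq_lr_path:
  assumes "distinct \<sigma>" "\<sigma> \<noteq> []" "0 < hd \<sigma>"
  shows "Phi \<sigma> = lr_path 0 \<sigma>"
proof -
  have "lr_max_blocks \<sigma> \<noteq> []" using assms(2) by (cases \<sigma>) auto
  note eq = blocks_path_eq[OF this]
  have "Phi \<sigma> = blocks_path 0 (lr_max_blocks \<sigma>)"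
    unfolding eq Phi_def last_block_path_def Let_def by (rule refl)
  then show ?thesis using blocks_path_lr_max_blocks assms by simp
qed

section \<open>Permutations generated by forced choices\<close>

text \<open>Every entry \<open>x\<close> that is not a left-to-right maximum is determined by the set of the remaining
  entries up to at most one binary choice: before the maximum it is selected by \<open>f\<close> from the
  remaining entries below the current left-to-right maximum \<open>m\<close>, and after the maximum it is either
  the largest remaining entry or the one selected by \<open>g\<close>.\<close>

fun forced :: "(nat set \<Rightarrow> nat) \<Rightarrow> (nat set \<Rightarrow> nat) \<Rightarrow> nat \<Rightarrow> nat list \<Rightarrow> bool" where
  "forced f g m [] = True"
| "forced f g m (x # xs) =
    ((m < x \<or>
       (if \<exists>y\<in>set xs. m < y then x = f {y \<in> set (x # xs). y < m}
        else x = Max (set (x # xs)) \<or> x = g (set (x # xs))))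
     \<and> forced f g (max m x) xs)"

section \<open>The path is a Dyck prefix of the right length\<close>

lemma length_lr_path_last_block: "\<forall>x\<in>set xs. x < m \<Longrightarrow> length (lr_path m xs) = length xs - 1"
  by (simp add: lr_path_last_block last_block_path_def)

lemma lr_path_dyck:
  assumes "distinct xs" "set xs = A \<union> {m<..N}" "A \<subseteq> {..<m}" "m < N"
  shows "length (lr_path m xs) = card A + 2 * (N - 1 - m) \<and> dyck_from (card A) (lr_path m xs)"
  using assms
proof (induction xs arbitrary: m A)
  case (Cons x xs)
  have fin: "finite A" using Cons.prems(3) finite_subset by blast
  have x: "x \<in> A \<union> {m<..N}" "x \<notin> set xs" using Cons.prems(1,2) by auto
  then have xs: "set xs = (A \<union> {m<..N}) - {x}" using Cons.prems(2) by auto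
  consider "x \<in> A" | "m < x" "x < N" | "x = N" using x(1) by force
  then show ?case
  proof cases
    case 1
    then have "x < m" using Cons.prems(3) by auto
    have N: "N \<in> set xs" using xs 1 Cons.prems(3,4) by auto
    have "{m<..N} - {x} = {m<..N}" using \<open>x < m\<close> by simp
    then have "set xs = (A - {x}) \<union> {m<..N}" unfolding xs Un_Diff by simp
    moreover have "A - {x} \<subseteq> {..<m}" using Cons.prems(3) by auto
    ultimately have "length (lr_path m xs) = card (A - {x}) + 2 * (N - 1 - m)
        \<and> dyck_from (card (A - {x})) (lr_path m xs)"
      using Cons.IH[of "A - {x}" m] Cons.prems(1,4) by simp
    moreover have "card (A - {x}) = card A - 1" "card A > 0"
      using 1 fin card_gt_0_iff by auto
    moreover have "\<exists>y\<in>set xs. m < y" "xs \<noteq> []" using N Cons.prems(4) by auto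
    then have "lr_path m (x # xs) = D # lr_path m xs"
      using \<open>x < m\<close> by (simp add: max_def)
    ultimately show ?thesis by simp
  next
    case 2
    have N: "N \<in> set xs" using xs 2 by auto
    then have ne: "xs \<noteq> []" by auto
    have "{m<..N} - {x} = {m<..<x} \<union> {x<..N}" using 2 by auto
    moreover have "A - {x} = A" using 2 Cons.prems(3) by auto
    ultimately have "set xs = (A \<union> {m<..<x}) \<union> {x<..N}"
      unfolding xs Un_Diff by (simp only: Un_assoc)
    moreover have "A \<union> {m<..<x} \<subseteq> {..<x}" using 2 Cons.prems(3) by auto
    ultimately have IH: "length (lr_path x xs) = card (A \<union> {m<..<x}) + 2 * (N - 1 - x)
        \<and> dyck_from (card (A \<union> {m<..<x})) (lr_path x xs)"
      using Cons.IH[of "A \<union> {m<..<x}" x] Cons.prems(1) 2 by simp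
    have "card (A \<union> {m<..<x}) = card A + (x - m - 1)"
      using fin Cons.prems(3) by (subst card_Un_disjoint) auto
    moreover have "lr_path m (x # xs) = replicate (x - m) U @ D # lr_path x xs"
      using N 2 ne by (auto simp: max_def)
    ultimately show ?thesis using IH 2 by (auto simp: dyck_from_replicate_U)
  next
    case 3
    have "{m<..N} - {x} = {m<..<N}" using 3 by auto
    moreover have "A - {x} = A" using 3 Cons.prems(3,4) by auto
    ultimately have xs': "set xs = A \<union> {m<..<N}" unfolding xs Un_Diff by simp
    have lt: "\<forall>y\<in>set xs. y < N" using xs' Cons.prems(3,4) by auto
    have "length xs = card (A \<union> {m<..<N})"
      using xs' distinct_card Cons.prems(1) by (metis distinct.simps(2))
    also have "\<dots> = card A + (N - m - 1)"
      using fin Cons.prems(3) by (subst card_Un_disjoint) auto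
    finally have len: "length xs = card A + (N - m - 1)" .
    show ?thesis
    proof (cases "xs = []")
      case True
      then show ?thesis using len by simp
    next
      case False
      have "lr_path m (x # xs) = replicate (N - m) U @ lr_path N xs"
        using lt 3 False Cons.prems(4) by (auto simp: max_def)
      moreover have l: "length (lr_path N xs) = length xs - 1"
        using length_lr_path_last_block lt by blast
      moreover have "length xs > 0" using False by simp
      moreover have "dyck_from (card A + (N - m)) (lr_path N xs)"
        using l len by (intro dyck_from_of_length_le) linarith
      ultimately show ?thesis using len Cons.prems(4) by (simp add: dyck_from_replicate_U)
    qed
  qed
qed simp

section \<open>Injectivity: recovering a permutation from its path\<close>

lemma takeWhile_replicate_append:
  "P c \<Longrightarrow> takeWhile P (replicate j c @ p) = replicate j c @ takeWhile P p"
  by (induction j) auto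

text \<open>The first entry is recovered from the number of leading up-steps.\<close>

lemma leading_ups_lr_path:
  assumes "m \<noteq> x" "xs \<noteq> []" "distinct (x # xs)" "m < Max (set (x # xs))"
  shows "min (length (takeWhile (\<lambda>s. s = U) (lr_path m (x # xs)))) (Max (set (x # xs)) - m) = x - m"
proof -
  define N where "N = Max (set (x # xs))"
  have N: "N \<in> set (x # xs)" "\<forall>y\<in>set (x # xs). y \<le> N"
    unfolding N_def by (auto simp del: set_simps intro: Max_in)
  consider "x < m" | "m < x" "x \<noteq> N" | "m < x" "x = N" using assms(1) by linarith
  then have "min (length (takeWhile (\<lambda>s. s = U) (lr_path m (x # xs)))) (N - m) = x - m"
  proof cases
    case 1
    then have "N \<in> set xs" using N assms(4)[folded N_def] by auto
    then have "\<exists>y\<in>set xs. m < y" using assms(4)[folded N_def] by blast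
    then show ?thesis using 1 assms(2) by simp
  next
    case 2
    then have "\<exists>y\<in>set xs. x < y" using N by (metis le_neq_implies_less list.set_intros(1) set_ConsD)
    then show ?thesis using 2 N assms(2) by (auto simp: takeWhile_replicate_append min_def)
  next
    \<comment> \<open>No \<open>D\<close> follows the \<open>N - m\<close> up-steps of the overall
      maximum, and the last block may itself start with \<open>U\<close>; the \<open>min\<close>
      cuts off this excess.\<close>
    case 3
    then have "\<not> (\<exists>y\<in>set xs. x < y)" using N by force
    then show ?thesis using 3 assms(2) by (simp add: takeWhile_replicate_append)
  qed
  then show ?thesis unfolding N_def .
qed

text \<open>The remaining entries form the same set \<open>R\<close> on both sides, so it suffices
  to recover the head. Before the maximum the leading up-steps give it, or show that
  \<open>f\<close> selects it; afterwards the first step separates \<open>Max R\<close> from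
  \<open>g R\<close>, which are distinct by \<open>g\<close>.\<close>

lemma lr_path_inj:
  assumes "distinct xs" "distinct ys" "set xs = set ys" "m \<notin> set xs"
    and "forced f g m xs" "forced f g m ys" "lr_path m xs = lr_path m ys"
    and g: "\<And>A. finite A \<Longrightarrow> card A > 1 \<Longrightarrow> g A \<in> A - {Max A}"
  shows "xs = ys"
  using assms(1-7)
proof (induction xs arbitrary: ys m)
  case (Cons x xs)
  obtain y ys' where ys: "ys = y # ys'" using Cons.prems(3) by (cases ys) auto
  define R where "R = set (x # xs)"
  have R: "finite R" "R = set (y # ys')" "x \<in> R" "y \<in> R"
    using Cons.prems(3) ys by (auto simp: R_def)
  have len: "length (x # xs) = length (y # ys')"
    using Cons.prems(1-3) ys by (metis distinct_card)
  have m: "m \<noteq> x" "m \<noteq> y" "m \<notin> set xs" "m \<notin> set ys'" using Cons.prems(3,4) ys by auto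
  have "x = y"
  proof (cases "xs = []")
    case True
    then show ?thesis using R len by (auto simp: R_def)
  next
    case ne: False
    then have ne': "ys' \<noteq> []" using len by auto
    show ?thesis
    proof (cases "m < Max R")
      case True
      have "min (length (takeWhile (\<lambda>s. s = U) (lr_path m (x # xs)))) (Max R - m) = x - m"
        using leading_ups_lr_path[OF m(1) ne Cons.prems(1)] True unfolding R_def by blast
      moreover have "min (length (takeWhile (\<lambda>s. s = U) (lr_path m (y # ys')))) (Max R - m) = y - m"
        using leading_ups_lr_path[OF m(2) ne' Cons.prems(2)[unfolded ys]] True
        unfolding R(2) by blast
      ultimately have "x - m = y - m" by (simp only: Cons.prems(7) ys)
      \<comment> \<open>As \<open>m\<close> is neither entry, the truncated differences vanish
        exactly for entries below \<open>m\<close>; this is the only case in which they do not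
        determine the entry.\<close>
      moreover have ?thesis if "x < m" "y < m"
      proof -
        have "Max R \<in> R" using R(1,3) by (intro Max_in) auto
        then have "\<exists>z\<in>set xs. m < z" "\<exists>z\<in>set ys'. m < z"
          using True that R unfolding R_def by (metis not_less_iff_gr_or_eq set_ConsD)+
        then have "x = f {z \<in> set (x # xs). z < m}" "y = f {z \<in> set (y # ys'). z < m}"
          using Cons.prems(5,6) that unfolding ys forced.simps by auto
        then show ?thesis unfolding R_def[symmetric] R(2)[symmetric] by simp
      qed
      ultimately show ?thesis using m by linarith
    next
      case False
      then have le: "\<forall>z\<in>R. z \<le> m" using R(1) by (meson Max_ge le_trans not_le_imp_less)
      have "card R = length (x # xs)" unfolding R_def by (rule distinct_card[OF Cons.prems(1)])
      then have "card R > 1" using ne by (cases xs) auto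
      then have gR: "g R \<noteq> Max R" using g R(1) by blast
      have le': "\<not> m < x" "\<not> m < y" "\<not> (\<exists>z\<in>set xs. m < z)" "\<not> (\<exists>z\<in>set ys'. m < z)"
        using le R unfolding R_def by (auto simp: not_less)
      have "lr_path m (x # xs) = (if x = Max R then U else D) # lr_path m xs"
        using ne le' unfolding R_def by (simp del: list.set add: max_def)
      moreover have "lr_path m (y # ys') = (if y = Max R then U else D) # lr_path m ys'"
        using ne' le' unfolding R(2) by (simp del: list.set add: max_def)
      ultimately have "(x = Max R) = (y = Max R)"
        using Cons.prems(7) unfolding ys by (simp split: if_splits)
      moreover have "x = Max R \<or> x = g R"
        using Cons.prems(5) le' unfolding R_def forced.simps by argo
      moreover have "y = Max R \<or> y = g R"
        using Cons.prems(6) le' unfolding R(2) ys forced.simps by argo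
      ultimately show ?thesis by auto
    qed
  qed
  have sets: "set xs = set ys'"
    using Cons.prems(1-3) ys \<open>x = y\<close> by auto
  moreover have "lr_path (max m x) xs = lr_path (max m x) ys'"
  proof (cases "xs = []")
    case False
    then have "ys' \<noteq> []" using len by auto
    then show ?thesis using Cons.prems(7) False sets ys \<open>x = y\<close> by simp
  qed (use sets in simp)
  ultimately have "xs = ys'"
    using Cons.prems m ys \<open>x = y\<close> by (intro Cons.IH[of ys' "max m x"]) (auto simp: max_def)
  then show ?case using ys \<open>x = y\<close> by simp
qed simp

section \<open>Surjectivity: constructing a permutation from a path\<close>

lemma lr_path_surj_last_block:
  assumes "finite A" "A \<noteq> {}" "\<forall>x\<in>A. x < m" "length q = card A - 1"
    and g: "\<And>A. finite A \<Longrightarrow> card A > 1 \<Longrightarrow> g A \<in> A - {Max A}"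
  shows "\<exists>xs. distinct xs \<and> set xs = A \<and> forced f g m xs \<and> lr_path m xs = q"
  using assms(1-4)
proof (induction q arbitrary: A)
  case Nil
  then have "card A = 1" by (metis card_gt_0_iff diff_is_0_eq le_antisym less_eq_Suc_le list.size(3) One_nat_def)
  then obtain a where "A = {a}" using card_1_singletonE by blast
  then show ?case by (intro exI[of _ "[a]"]) auto
next
  case (Cons c q)
  then have card: "card A > 1" by simp
  \<comment> \<open>\<open>U\<close> is realised by the greatest entry and \<open>D\<close> by
    \<open>g A\<close>, which is a different entry because \<open>A\<close> has at least two
    elements.\<close>
  define x where "x = (if c = U then Max A else g A)"
  have x: "x \<in> A" "x = Max A \<or> x = g A" "x = Max A \<longleftrightarrow> c = U"
    using g[OF Cons.prems(1) card] Cons.prems(1,2) by (auto simp: x_def)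
  have c: "card (A - {x}) = card A - 1" using x by simp
  then have ne: "A - {x} \<noteq> {}" using card by (metis card.empty less_numeral_extra(3) zero_less_diff)
  have "\<exists>xs. distinct xs \<and> set xs = A - {x} \<and> forced f g m xs \<and> lr_path m xs = q"
    by (rule Cons.IH) (use Cons.prems ne c in auto)
  then obtain xs where xs: "distinct xs" "set xs = A - {x}" "forced f g m xs" "lr_path m xs = q"
    by blast
  have A: "set (x # xs) = A" using xs x by auto
  have lt: "\<not> (\<exists>y\<in>set xs. m < y)" "x < m" using xs(2) x(1) Cons.prems(3) by auto
  have "forced f g m (x # xs)"
    using xs(3) lt x(2) A by (simp del: set_simps list.set add: max_def)
  moreover have "xs \<noteq> []" using xs(2) ne by (metis empty_set)
  then have "lr_path m (x # xs) = c # q"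
    using xs(4) lt x(3) A by (cases c) (simp_all del: set_simps list.set add: max_def)
  moreover have "distinct (x # xs)" using xs(1,2) by simp
  ultimately show ?case using A by blast
qed

lemma lr_path_surj:
  assumes "m < N" "A \<subseteq> {..<m}" "length p = card A + 2 * (N - 1 - m)" "dyck_from (card A) p"
    and f: "\<And>A. finite A \<Longrightarrow> A \<noteq> {} \<Longrightarrow> f A \<in> A"
    and g: "\<And>A. finite A \<Longrightarrow> card A > 1 \<Longrightarrow> g A \<in> A - {Max A}"
  shows "\<exists>xs. distinct xs \<and> set xs = A \<union> {m<..N} \<and> forced f g m xs \<and> lr_path m xs = p"
  using assms(1-4)
proof (induction p arbitrary: m A rule: length_induct)
  case (1 p)
  have fin: "finite A" using "1.prems"(2) finite_subset by blast
  define j where "j = length (takeWhile (\<lambda>s. s = U) p)"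
  define r where "r = dropWhile (\<lambda>s. s = U) p"
  have "takeWhile (\<lambda>s. s = U) p = replicate j U"
    unfolding j_def by (rule replicate_eqI) (auto dest: set_takeWhileD)
  then have p: "p = replicate j U @ r" unfolding r_def by (metis takeWhile_dropWhile_id)
  show ?case
  \<comment> \<open>The empty path joins the first case: \<open>N\<close> alone is left and, being
    the last entry, emits no step.\<close>
  proof (cases "N - m \<le> j \<or> p = []")
    case final: True
    define B where "B = A \<union> {m<..<N}"
    have B: "finite B" "\<forall>x\<in>B. x < N" using fin "1.prems"(1,2) by (auto simp: B_def)
    have card: "card B = card A + (N - m - 1)"
      unfolding B_def using fin "1.prems"(2) by (subst card_Un_disjoint) auto
    have N: "insert N B = A \<union> {m<..N}" using "1.prems"(1) by (auto simp: B_def)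
    show ?thesis
    proof (cases "B = {}")
      case True
      then have "p = []" using card "1.prems"(3) by auto
      then show ?thesis using N True "1.prems"(1) by (intro exI[of _ "[N]"]) auto
    next
      case False
      then have "card B > 0" using B by (simp add: card_gt_0_iff)
      then have le: "N - m \<le> j" using final card "1.prems"(3) by auto
      define q where "q = drop (N - m) p"
      have pq: "p = replicate (N - m) U @ q"
        using le unfolding q_def p by simp (metis le_add_diff_inverse replicate_add append.assoc)
      then have "length p = (N - m) + length q" by simp
      then have "length q = card B - 1" using card "1.prems"(1,3) by linarith
      then obtain xs where xs: "distinct xs" "set xs = B" "forced f g N xs" "lr_path N xs = q"
        using lr_path_surj_last_block[OF B(1) False B(2), of q g f] g by blast
      have "lr_path m (N # xs) = p"
        using xs(2,4) B(2) False "1.prems"(1) unfolding pq by (auto simp: max_def)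
      moreover have "forced f g m (N # xs)" using xs(3) "1.prems"(1) by (simp add: max_def)
      ultimately show ?thesis
        using xs(1,2) N B(2) by (intro exI[of _ "N # xs"]) auto
    qed
  next
    case False
    \<comment> \<open>A nonempty path of \<open>j < N - m\<close> up-steps only is too short, its
      prescribed length being at least \<open>2 * (N - 1 - m)\<close>, hence at least
      \<open>2 * j\<close>.\<close>
    have "r \<noteq> []"
    proof
      assume "r = []"
      then have "length p = j" using p by simp
      moreover have "length p > 0" using False by auto
      ultimately show False using False "1.prems"(3) by linarith
    qed
    moreover have "hd r \<noteq> U" using hd_dropWhile[of "\<lambda>s. s = U" p] \<open>r \<noteq> []\<close> unfolding r_def by blast
    ultimately obtain r' where r: "r = D # r'" by (metis step.exhaust list.exhaust_sel)
    have len: "length p = j + 1 + length r'" using p r by simp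
    have dyck: "card A + j > 0" "dyck_from (card A + j - 1) r'"
      using "1.prems"(4) unfolding p r dyck_from_replicate_U by auto
    show ?thesis
    proof (cases "j = 0")
      case True
      \<comment> \<open>A down-step is possible only at positive height, so there is an entry for
        \<open>f\<close> to select.\<close>
      then have "A \<noteq> {}" using dyck by auto
      define x where "x = f A"
      have x: "x \<in> A" "x < m" using f[OF fin \<open>A \<noteq> {}\<close>] "1.prems"(2) by (auto simp: x_def)
      have card: "card (A - {x}) = card A - 1" using x by simp
      have "length r' = card (A - {x}) + 2 * (N - 1 - m)"
        using len card dyck(1) "1.prems"(3) True by linarith
      moreover have "A - {x} \<subseteq> {..<m}" using "1.prems"(2) by auto
      moreover have "dyck_from (card (A - {x})) r'" using dyck(2) card True by simp
      ultimately obtain xs where xs: "distinct xs" "set xs = (A - {x}) \<union> {m<..N}" "forced f g m xs"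
          "lr_path m xs = r'"
        using "1.IH"[rule_format, of r' m "A - {x}"] "1.prems"(1) len by auto
      have "{y \<in> set (x # xs). y < m} = A" using xs(2) x "1.prems"(2) by auto
      then have "x = f {y \<in> set (x # xs). y < m}" unfolding x_def by simp
      moreover have ex: "\<exists>y\<in>set xs. m < y" "xs \<noteq> []" using xs(2) "1.prems"(1) by auto
      moreover have "max m x = m" using x by simp
      ultimately have "forced f g m (x # xs)" using xs(3) unfolding forced.simps by argo
      moreover have "lr_path m (x # xs) = p" using ex xs(4) x p r True by (simp add: max_def)
      moreover have "distinct (x # xs)" using xs(1,2) x by simp
      moreover have "set (x # xs) = A \<union> {m<..N}" using xs(2) x by auto
      ultimately show ?thesis by blast
    next
      case False
      define x where "x = m + j"
      have x: "m < x" "x < N" using False \<open>\<not> (N - m \<le> j \<or> p = [])\<close> by (auto simp: x_def)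
      define B where "B = A \<union> {m<..<x}"
      have card: "card B = card A + j - 1"
        unfolding B_def using fin "1.prems"(2) False
        by (subst card_Un_disjoint) (auto simp: x_def)
      have "length r' = card B + 2 * (N - 1 - x)"
        using len card "1.prems"(3) x False by (simp add: x_def)
      moreover have "B \<subseteq> {..<x}" using "1.prems"(2) x by (auto simp: B_def)
      moreover have "dyck_from (card B) r'" using dyck(2) card by simp
      moreover have "length r' < length p" using len by simp
      ultimately obtain xs where xs: "distinct xs" "set xs = B \<union> {x<..N}" "forced f g x xs"
          "lr_path x xs = r'"
        using "1.IH"[rule_format, of r' x B] x(2) by blast
      have "\<exists>y\<in>set xs. x < y" "xs \<noteq> []" using xs(2) x by auto
      then have "lr_path m (x # xs) = p" using xs(4) x p r by (simp add: max_def x_def)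
      moreover have "forced f g m (x # xs)" using xs(3) x by (simp add: max_def)
      moreover have "{m<..N} = insert x ({m<..<x} \<union> {x<..N})" using x by auto
      then have "set (x # xs) = A \<union> {m<..N}" using xs(2) by (simp add: B_def Un_assoc)
      moreover have "distinct (x # xs)" using xs(1,2) "1.prems"(2) x by (auto simp: B_def)
      ultimately show ?thesis by blast
    qed
  qed
qed

lemma bij_betw_lr_path:
  assumes f: "\<And>A. finite A \<Longrightarrow> A \<noteq> {} \<Longrightarrow> f A \<in> A"
    and g: "\<And>A. finite A \<Longrightarrow> card A > 1 \<Longrightarrow> g A \<in> A - {Max A}"
  shows "bij_betw (lr_path 0) {\<sigma>. distinct \<sigma> \<and> set \<sigma> = {1..n + 1} \<and> forced f g 0 \<sigma>}
      {p. dyck_prefix p \<and> length p = 2 * n}"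
proof -
  \<comment> \<open>The general statements are used with \<open>m = 0\<close>, \<open>A = {}\<close>
    and \<open>N = n + 1\<close>, that is, at height \<open>0\<close>.\<close>
  have int: "{1..n + 1} = {} \<union> {0<..n + 1}" by auto
  show ?thesis
    unfolding bij_betw_def int
  proof (intro conjI inj_onI subset_antisym subsetI)
    fix xs ys
    assume "xs \<in> {\<sigma>. distinct \<sigma> \<and> set \<sigma> = {} \<union> {0<..n + 1} \<and> forced f g 0 \<sigma>}"
      "ys \<in> {\<sigma>. distinct \<sigma> \<and> set \<sigma> = {} \<union> {0<..n + 1} \<and> forced f g 0 \<sigma>}"
      "lr_path 0 xs = lr_path 0 ys"
    then show "xs = ys" by (intro lr_path_inj[of xs ys 0 f g] g) auto
  next
    fix p
    assume "p \<in> lr_path 0 ` {\<sigma>. distinct \<sigma> \<and> set \<sigma> = {} \<union> {0<..n + 1} \<and> forced f g 0 \<sigma>}"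
    then show "p \<in> {p. dyck_prefix p \<and> length p = 2 * n}"
      using lr_path_dyck[of _ "{}" 0 "n + 1"] by (auto simp: dyck_prefix_iff_dyck_from)
  next
    fix p
    assume p: "p \<in> {p. dyck_prefix p \<and> length p = 2 * n}"
    show "p \<in> lr_path 0 ` {\<sigma>. distinct \<sigma> \<and> set \<sigma> = {} \<union> {0<..n + 1} \<and> forced f g 0 \<sigma>}"
    proof -
      have "\<exists>xs. distinct xs \<and> set xs = {} \<union> {0<..n + 1} \<and> forced f g 0 xs \<and> lr_path 0 xs = p"
        by (rule lr_path_surj) (use p f g in \<open>auto simp: dyck_prefix_iff_dyck_from\<close>)
      then show ?thesis by blast
    qed
  qed
qed

section \<open>Pattern avoidance\<close>

text \<open>Both \<open>T1\<close> and \<open>T2\<close> are closed under exchanging the last two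
  letters, so the order of \<open>y\<close> and \<open>z\<close> is left free and the pattern set
  enters only through the condition \<open>Q\<close> on the values.\<close>

definition occurs :: "(nat \<Rightarrow> nat \<Rightarrow> nat \<Rightarrow> nat \<Rightarrow> bool) \<Rightarrow> nat list \<Rightarrow> bool" where
  "occurs Q \<sigma> \<longleftrightarrow>
    (\<exists>a x y z. (subseq [a, x, y, z] \<sigma> \<or> subseq [a, x, z, y] \<sigma>) \<and> x < a \<and> Q a x y z)"

definition occurs_below :: "(nat \<Rightarrow> nat \<Rightarrow> nat \<Rightarrow> nat \<Rightarrow> bool) \<Rightarrow> nat \<Rightarrow> nat list \<Rightarrow> bool" where
  "occurs_below Q a \<sigma> \<longleftrightarrow>
    (\<exists>x y z. (subseq [x, y, z] \<sigma> \<or> subseq [x, z, y] \<sigma>) \<and> x < a \<and> Q a x y z)"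

lemma subseq_Cons_iff:
  "subseq (x # xs) (y # ys) \<longleftrightarrow> (x = y \<and> subseq xs ys) \<or> subseq (x # xs) ys"
  by (metis subseq_Cons2_iff subseq_Cons')

lemma subseq_pair_iff:
  "y \<noteq> z \<Longrightarrow> subseq [y, z] xs \<or> subseq [z, y] xs \<longleftrightarrow> y \<in> set xs \<and> z \<in> set xs"
  by (induction xs) (auto simp: subseq_Cons_iff subseq_singleton_left)

lemma occurs_Cons: "occurs Q (m # xs) \<longleftrightarrow> occurs_below Q m xs \<or> occurs Q xs"
  unfolding occurs_def occurs_below_def subseq_Cons_iff by blast

lemma occurs_below_Cons:
  assumes "\<And>a x y z. Q a x y z \<Longrightarrow> y \<noteq> z"
  shows "occurs_below Q m (x # xs) \<longleftrightarrow>
    (x < m \<and> (\<exists>y\<in>set xs. \<exists>z\<in>set xs. Q m x y z)) \<or> occurs_below Q m xs"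
proof -
  have step: "occurs_below Q m (x # xs) \<longleftrightarrow>
      (x < m \<and> (\<exists>y z. (subseq [y, z] xs \<or> subseq [z, y] xs) \<and> Q m x y z)) \<or> occurs_below Q m xs"
    unfolding occurs_below_def subseq_Cons_iff[of _ "_ # _" x xs] by blast
  have pair: "(subseq [y, z] xs \<or> subseq [z, y] xs) \<and> Q m x y z \<longleftrightarrow>
      y \<in> set xs \<and> z \<in> set xs \<and> Q m x y z" for y z
    using assms subseq_pair_iff[of y z xs] by blast
  show ?thesis unfolding step pair by blast
qed

text \<open>A larger \<open>a\<close> keeps every occurrence, so of all preceding entries only the
  maximum matters.\<close>

lemma occurs_below_max:
  assumes "\<And>a b x y z. a \<le> b \<Longrightarrow> Q a x y z \<Longrightarrow> Q b x y z"
  shows "occurs_below Q (max m x) xs \<longleftrightarrow> occurs_below Q m xs \<or> occurs_below Q x xs"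
proof -
  have "occurs_below Q b xs" if "occurs_below Q a xs" "a \<le> b" for a b
    using that assms unfolding occurs_below_def by (meson order_less_le_trans)
  then show ?thesis by (metis max.cobounded1 max.cobounded2 max_def)
qed

text \<open>Here \<open>m\<close> stands for all entries already read. By \<open>choice\<close>, an
  entry \<open>x < m\<close> can be the second letter of an occurrence exactly when it breaks the
  local rule of \<open>forced\<close>; all other occurrences survive in
  \<open>max m x # xs\<close>.\<close>

lemma not_occurs_Cons_iff_forced:
  assumes ne: "\<And>a x y z. Q a x y z \<Longrightarrow> y \<noteq> z"
    and mono: "\<And>a b x y z. a \<le> b \<Longrightarrow> Q a x y z \<Longrightarrow> Q b x y z"
    and choice: "\<And>m x X. finite X \<Longrightarrow> x \<notin> X \<Longrightarrow> m \<notin> X \<Longrightarrow> x < m \<Longrightarrow>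
      (\<exists>y\<in>X. \<exists>z\<in>X. Q m x y z) \<longleftrightarrow>
      \<not> (if \<exists>y\<in>X. m < y then x = f {y \<in> insert x X. y < m}
         else x = Max (insert x X) \<or> x = g (insert x X))"
    and "distinct (m # xs)"
  shows "\<not> occurs Q (m # xs) \<longleftrightarrow> forced f g m xs"
  using assms(4)
proof (induction xs arbitrary: m)
  case Nil
  then show ?case by (simp add: occurs_def)
next
  case (Cons x xs)
  have "occurs_below Q m (x # xs) \<longleftrightarrow>
      (x < m \<and> (\<exists>y\<in>set xs. \<exists>z\<in>set xs. Q m x y z)) \<or> occurs_below Q m xs"
    by (rule occurs_below_Cons) (rule ne)
  moreover have "occurs_below Q (max m x) xs \<longleftrightarrow> occurs_below Q m xs \<or> occurs_below Q x xs"
    by (rule occurs_below_max) (rule mono)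
  ultimately have "occurs Q (m # x # xs) \<longleftrightarrow>
      (x < m \<and> (\<exists>y\<in>set xs. \<exists>z\<in>set xs. Q m x y z)) \<or> occurs Q (max m x # xs)"
    unfolding occurs_Cons by blast
  moreover have "\<not> occurs Q (max m x # xs) \<longleftrightarrow> forced f g (max m x) xs"
    using Cons.prems by (intro Cons.IH) (auto simp: max_def)
  moreover have "(\<exists>y\<in>set xs. \<exists>z\<in>set xs. Q m x y z) \<longleftrightarrow>
      \<not> (if \<exists>y\<in>set xs. m < y then x = f {y \<in> insert x (set xs). y < m}
         else x = Max (insert x (set xs)) \<or> x = g (insert x (set xs)))" if "x < m"
    by (rule choice) (use that Cons.prems in auto)
  moreover have "m < x \<longleftrightarrow> \<not> x < m" using Cons.prems by auto
  ultimately show ?case unfolding forced.simps list.set by blast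
qed

text \<open>The prepended \<open>0\<close> is the initial running maximum; it starts no occurrence
  because nothing lies below it.\<close>

lemma occurs_0_Cons: "occurs Q (0 # xs) \<longleftrightarrow> occurs Q xs"
  by (simp add: occurs_Cons occurs_below_def)

section \<open>The pattern sets \<open>T1\<close> and \<open>T2\<close>\<close>

lemma same_relative_order_length4:
  "same_relative_order [a, b, c, d] [p, q, r, s] \<longleftrightarrow>
    (a < b \<longleftrightarrow> p < q) \<and> (a < c \<longleftrightarrow> p < r) \<and> (a < d \<longleftrightarrow> p < s) \<and>
    (b < a \<longleftrightarrow> q < p) \<and> (b < c \<longleftrightarrow> q < r) \<and> (b < d \<longleftrightarrow> q < s) \<and>
    (c < a \<longleftrightarrow> r < p) \<and> (c < b \<longleftrightarrow> r < q) \<and> (c < d \<longleftrightarrow> r < s) \<and>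
    (d < a \<longleftrightarrow> s < p) \<and> (d < b \<longleftrightarrow> s < q) \<and> (d < c \<longleftrightarrow> s < r)"
  by (simp add: same_relative_order_def All_less_Suc numeral_eq_Suc conj_ac)

lemma avoids_iff_not_occurs:
  assumes patterns: "\<And>a x y z. distinct [a, x, y, z] \<Longrightarrow>
      (\<exists>\<tau>\<in>T. same_relative_order [a, x, y, z] \<tau>) \<longleftrightarrow> x < a \<and> (Q a x y z \<or> Q a x z y)"
    and len: "\<forall>\<tau>\<in>T. length \<tau> = 4"
    and "distinct \<sigma>"
  shows "(\<forall>\<tau>\<in>T. avoids \<sigma> \<tau>) \<longleftrightarrow> \<not> occurs Q \<sigma>"
proof -
  have "\<exists>a x y z. \<rho> = [a, x, y, z]" if "\<tau> \<in> T" "same_relative_order \<rho> \<tau>" for \<rho> \<tau>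
    using that len by (auto simp: same_relative_order_def numeral_eq_Suc length_Suc_conv)
  then have "(\<forall>\<tau>\<in>T. avoids \<sigma> \<tau>) \<longleftrightarrow>
      (\<nexists>a x y z. subseq [a, x, y, z] \<sigma> \<and> (\<exists>\<tau>\<in>T. same_relative_order [a, x, y, z] \<tau>))"
    unfolding avoids_def by metis
  moreover have "distinct \<rho>" if "subseq \<rho> \<sigma>" for \<rho>
    using that \<open>distinct \<sigma>\<close> distinct_nthsI unfolding subseq_conv_nths by blast
  then have "subseq [a, x, y, z] \<sigma> \<and> (\<exists>\<tau>\<in>T. same_relative_order [a, x, y, z] \<tau>) \<longleftrightarrow>
      subseq [a, x, y, z] \<sigma> \<and> x < a \<and> (Q a x y z \<or> Q a x z y)" for a x y z
    using patterns by blast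
  ultimately have "(\<forall>\<tau>\<in>T. avoids \<sigma> \<tau>) \<longleftrightarrow>
      (\<nexists>a x y z. subseq [a, x, y, z] \<sigma> \<and> x < a \<and> (Q a x y z \<or> Q a x z y))"
    by (simp only:)
  then show ?thesis unfolding occurs_def by blast
qed

lemma same_relative_order_T1:
  "same_relative_order [a, x, y, z] [3, 2, 1, 4] \<longleftrightarrow> y < x \<and> x < a \<and> a < z"
  "same_relative_order [a, x, y, z] [3, 2, 4, 1] \<longleftrightarrow> z < x \<and> x < a \<and> a < y"
  "same_relative_order [a, x, y, z] [4, 2, 1, 3] \<longleftrightarrow> y < x \<and> x < z \<and> z < a"
  "same_relative_order [a, x, y, z] [4, 2, 3, 1] \<longleftrightarrow> z < x \<and> x < y \<and> y < a"
  unfolding same_relative_order_length4 by auto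

lemma avoids_T1_iff:
  "distinct \<sigma> \<Longrightarrow> (\<forall>\<tau>\<in>T1. avoids \<sigma> \<tau>) \<longleftrightarrow> \<not> occurs (\<lambda>a x y z. y < x \<and> x < z) \<sigma>"
  by (rule avoids_iff_not_occurs) (auto simp: T1_def same_relative_order_T1 simp del: One_nat_def)

lemma same_relative_order_T2:
  "same_relative_order [a, x, y, z] [3, 1, 2, 4] \<longleftrightarrow> x < y \<and> y < a \<and> a < z"
  "same_relative_order [a, x, y, z] [3, 1, 4, 2] \<longleftrightarrow> x < z \<and> z < a \<and> a < y"
  "same_relative_order [a, x, y, z] [4, 1, 2, 3] \<longleftrightarrow> x < y \<and> y < z \<and> z < a"
  "same_relative_order [a, x, y, z] [4, 1, 3, 2] \<longleftrightarrow> x < z \<and> z < y \<and> y < a"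
  unfolding same_relative_order_length4 by auto

lemma avoids_T2_iff:
  "distinct \<sigma> \<Longrightarrow> (\<forall>\<tau>\<in>T2. avoids \<sigma> \<tau>) \<longleftrightarrow> \<not> occurs (\<lambda>a x y z. x < y \<and> y < z \<and> y < a) \<sigma>"
  by (rule avoids_iff_not_occurs) (auto simp: T2_def same_relative_order_T2 simp del: One_nat_def)

text \<open>Without \<open>y < x < z\<close>, the entry \<open>x\<close> is least or greatest among
  those remaining. An entry above \<open>m\<close> excludes the latter, and then least overall is
  the same as least below \<open>m\<close>.\<close>

lemma forced_choice_T1:
  fixes m x :: nat
  assumes "finite X" "x \<notin> X" "m \<notin> X" "x < m"
  shows "(\<exists>y\<in>X. \<exists>z\<in>X. y < x \<and> x < z) \<longleftrightarrow>
      \<not> (if \<exists>y\<in>X. m < y then x = Min {y \<in> insert x X. y < m}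
         else x = Max (insert x X) \<or> x = Min (insert x X))"
proof -
  have "x = Min {y \<in> insert x X. y < m} \<longleftrightarrow> (\<forall>y\<in>X. y < m \<longrightarrow> x \<le> y)"
    using assms by (subst eq_Min_iff) auto
  moreover have "x = Min (insert x X) \<longleftrightarrow> (\<forall>y\<in>X. x \<le> y)"
    using assms by (subst eq_Min_iff) auto
  moreover have "x = Max (insert x X) \<longleftrightarrow> (\<forall>y\<in>X. y \<le> x)"
    using assms by (subst eq_Max_iff) auto
  ultimately show ?thesis using assms
    by (auto simp: not_less not_le)
qed

text \<open>An entry above \<open>m\<close> can serve as \<open>z\<close>, so nothing in
  \<open>X\<close> may lie between \<open>x\<close> and \<open>m\<close>. If there is none, all of
  \<open>X\<close> lies below \<open>m\<close> and at most one element may exceed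
  \<open>x\<close>.\<close>

lemma forced_choice_T2:
  fixes m x :: nat
  assumes "finite X" "x \<notin> X" "m \<notin> X" "x < m"
  shows "(\<exists>y\<in>X. \<exists>z\<in>X. x < y \<and> y < z \<and> y < m) \<longleftrightarrow>
      \<not> (if \<exists>y\<in>X. m < y then x = Max {y \<in> insert x X. y < m}
         else x = Max (insert x X) \<or> x = Max (insert x X - {Max (insert x X)}))"
proof (cases "\<exists>y\<in>X. m < y")
  case True
  have "x = Max {y \<in> insert x X. y < m} \<longleftrightarrow> (\<forall>y\<in>X. y < m \<longrightarrow> y \<le> x)"
    using assms by (subst eq_Max_iff) auto
  then show ?thesis using True by (auto simp: not_le) (meson less_trans)
next
  case False
  then have lt: "\<forall>y\<in>X. y < m" using assms(3) by (metis linorder_neqE_nat)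
  define M where "M = Max (insert x X)"
  have M: "M \<in> insert x X" "\<forall>y\<in>insert x X. y \<le> M"
    unfolding M_def using assms(1) Max_in[of "insert x X"] Max_ge[of "insert x X"] by blast+
  show ?thesis
  proof (cases "x = M")
    case True
    have "x = Max (insert x X)" using True unfolding M_def .
    moreover have "\<forall>y\<in>X. y \<le> x" using M(2) True by blast
    ultimately show ?thesis unfolding if_not_P[OF False] by (meson not_less)
  next
    case False
    then have "x = Max (insert x X - {M}) \<longleftrightarrow> (\<forall>y\<in>X. y \<noteq> M \<longrightarrow> y \<le> x)"
      using assms by (subst eq_Max_iff) auto
    moreover have "M \<in> X" using M False by auto
    \<comment> \<open>The greatest entry \<open>M\<close> can serve as \<open>z\<close>, so any
      other entry above \<open>x\<close> suffices as \<open>y\<close>.\<close>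
    then have "(\<exists>y\<in>X. \<exists>z\<in>X. x < y \<and> y < z \<and> y < m) \<longleftrightarrow> (\<exists>y\<in>X. y \<noteq> M \<and> x < y)"
      using M(2) lt by (metis insertCI le_neq_implies_less not_less)
    ultimately show ?thesis
      using False unfolding if_not_P[OF \<open>\<not> (\<exists>y\<in>X. m < y)\<close>] M_def[symmetric]
      by (auto simp: not_le)
  qed
qed

lemma Max_remove_Max:
  fixes A :: "nat set"
  assumes "finite A" "card A > 1"
  shows "Max (A - {Max A}) \<in> A - {Max A}"
proof (rule Max_in)
  show "A - {Max A} \<noteq> {}"
  proof
    assume "A - {Max A} = {}"
    then have "card A \<le> card {Max A}" by (intro card_mono) auto
    then show False using assms by simp
  qed
qed (use assms in simp)

lemma Min_neq_Max:
  fixes A :: "nat set"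
  assumes "finite A" "card A > 1"
  shows "Min A \<in> A - {Max A}"
proof -
  have "A \<noteq> {}" using assms by auto
  moreover have "Min A \<noteq> Max A"
  proof
    assume "Min A = Max A"
    then have "A \<subseteq> {Max A}" using assms by (metis Max_ge Min_le antisym insertI1 subsetI)
    then have "card A \<le> card {Max A}" by (intro card_mono) auto
    then show False using assms by simp
  qed
  ultimately show ?thesis using assms by simp
qed

section \<open>The bijections\<close>

text \<open>Isolates what depends on the pattern set: the condition \<open>Q\<close> and the
  selections \<open>f\<close> and \<open>g\<close>.\<close>

lemma bij_betw_Phi:
  assumes avoid: "\<And>\<sigma>. distinct \<sigma> \<Longrightarrow> (\<forall>\<tau>\<in>T. avoids \<sigma> \<tau>) \<longleftrightarrow> \<not> occurs Q \<sigma>"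
    and ne: "\<And>a x y z. Q a x y z \<Longrightarrow> y \<noteq> z"
    and mono: "\<And>a b x y z. a \<le> b \<Longrightarrow> Q a x y z \<Longrightarrow> Q b x y z"
    and choice: "\<And>m x X. finite X \<Longrightarrow> x \<notin> X \<Longrightarrow> m \<notin> X \<Longrightarrow> x < m \<Longrightarrow>
      (\<exists>y\<in>X. \<exists>z\<in>X. Q m x y z) \<longleftrightarrow>
      \<not> (if \<exists>y\<in>X. m < y then x = f {y \<in> insert x X. y < m}
         else x = Max (insert x X) \<or> x = g (insert x X))"
    and f: "\<And>A. finite A \<Longrightarrow> A \<noteq> {} \<Longrightarrow> f A \<in> A"
    and g: "\<And>A. finite A \<Longrightarrow> card A > 1 \<Longrightarrow> g A \<in> A - {Max A}"
  shows "bij_betw Phi (Av_n (n + 1) T) {p. dyck_prefix p \<and> length p = 2 * n}"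
proof -
  have "(\<forall>\<tau>\<in>T. avoids \<sigma> \<tau>) \<longleftrightarrow> forced f g 0 \<sigma>" if "distinct \<sigma>" "set \<sigma> = {1..n + 1}" for \<sigma>
  proof -
    have "\<not> occurs Q (0 # \<sigma>) \<longleftrightarrow> forced f g 0 \<sigma>"
      by (rule not_occurs_Cons_iff_forced; (fact ne mono choice | use that in simp))
    then show ?thesis using avoid[OF that(1)] by (simp add: occurs_0_Cons)
  qed
  then have "Av_n (n + 1) T = {\<sigma>. distinct \<sigma> \<and> set \<sigma> = {1..n + 1} \<and> forced f g 0 \<sigma>}"
    unfolding Av_n_def Av_def permutations_of_set_def by (auto intro: exI[of _ "n + 1"])
  moreover have "Phi \<sigma> = lr_path 0 \<sigma>" if "distinct \<sigma>" "set \<sigma> = {1..n + 1}" for \<sigma>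
  proof (rule Phi_eq_lr_path)
    show "\<sigma> \<noteq> []" using that by auto
    then have "hd \<sigma> \<in> {1..n + 1}" using that(2) hd_in_set by blast
    then show "0 < hd \<sigma>" by simp
  qed (use that in simp)
  moreover have "bij_betw (lr_path 0) {\<sigma>. distinct \<sigma> \<and> set \<sigma> = {1..n + 1} \<and> forced f g 0 \<sigma>}
      {p. dyck_prefix p \<and> length p = 2 * n}"
    by (rule bij_betw_lr_path; fact f g)
  ultimately show ?thesis
    by (subst bij_betw_cong[where g = "lr_path 0"]) auto
qed

lemma bij_betw_Phi_T1:
  "bij_betw Phi (Av_n (n + 1) T1) {p. dyck_prefix p \<and> length p = 2 * n}"
  by (rule bij_betw_Phi[where Q = "\<lambda>a x y z. y < x \<and> x < z" and f = Min and g = Min];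
      (fact avoids_T1_iff forced_choice_T1 Min_neq_Max | simp))

lemma bij_betw_Phi_T2:
  "bij_betw Phi (Av_n (n + 1) T2) {p. dyck_prefix p \<and> length p = 2 * n}"
  by (rule bij_betw_Phi[where Q = "\<lambda>a x y z. x < y \<and> y < z \<and> y < a" and f = Max
        and g = "\<lambda>A. Max (A - {Max A})"];
      (fact avoids_T2_iff forced_choice_T2 Max_remove_Max | simp))

text \<open>The bijections for the single sizes glue together because their targets are disjoint,
  the path length determining \<open>n\<close>.\<close>

lemma bij_betw_Phi_Av:
  assumes "\<And>n. bij_betw Phi (Av_n (n + 1) T) {p. dyck_prefix p \<and> length p = 2 * n}"
  shows "bij_betw Phi (Av T) {p. dyck_prefix p \<and> even (length p)}"
proof -
  have "Av T = (\<Union>n. Av_n (n + 1) T)"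
  proof
    show "Av T \<subseteq> (\<Union>n. Av_n (n + 1) T)"
    proof
      fix \<sigma> assume \<sigma>: "\<sigma> \<in> Av T"
      then obtain n where "n \<ge> 1" "\<sigma> \<in> permutations_of_set {1..n}" by (auto simp: Av_def)
      then have "\<sigma> \<in> Av_n (n - 1 + 1) T" using \<sigma> by (simp add: Av_n_def)
      then show "\<sigma> \<in> (\<Union>n. Av_n (n + 1) T)" by blast
    qed
  qed (auto simp: Av_n_def)
  moreover have "{p. dyck_prefix p \<and> even (length p)} =
      (\<Union>n. {p. dyck_prefix p \<and> length p = 2 * n})"
    by (auto elim!: evenE)
  moreover have "bij_betw Phi (\<Union>n. Av_n (n + 1) T) (\<Union>n. {p. dyck_prefix p \<and> length p = 2 * n})"
    by (rule bij_betw_UNION_disjoint)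
      (use assms in \<open>auto simp: disjoint_family_on_def\<close>)
  ultimately show ?thesis by simp
qed

theorem theorem4:
  shows "bij_betw Phi (Av T1) {p. dyck_prefix p \<and> even (length p)}
       \<and> bij_betw Phi (Av T2) {p. dyck_prefix p \<and> even (length p)}
       \<and> (\<forall>n. bij_betw Phi (Av_n (n + 1) T1) {p. dyck_prefix p \<and> length p = 2 * n})
       \<and> (\<forall>n. bij_betw Phi (Av_n (n + 1) T2) {p. dyck_prefix p \<and> length p = 2 * n})
       \<and> (\<forall>n. card (Av_n (n + 1) T1) = (2 * n) choose n)
       \<and> (\<forall>n. card (Av_n (n + 1) T2) = (2 * n) choose n)"
  using bij_betw_Phi_T1 bij_betw_Phi_T2 bij_betw_Phi_Av[OF bij_betw_Phi_T1]
    bij_betw_Phi_Av[OF bij_betw_Phi_T2] bij_betw_same_card[OF bij_betw_Phi_T1]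
    bij_betw_same_card[OF bij_betw_Phi_T2] card_dyck_prefix
  by simp

end
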